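(* For every nonzero rational number $r$, the number $\tan r$ is irrational.
   Context: Here $\tan$ is the usual real tangent function, with argument in radians. *)

theory Defs
  imports Complex_Main
begin

end

theory Submission
  imports Defs
begin

text \<open>
  The series \<open>F\<^sub>m(x) = \<Sum>\<^sub>k (-1)\<^sup>k (m + k)! x\<^sup>2\<^sup>k / (k! (2m + 2k)!)\<close>, a rescaled Bessel function of
  half-integer order, satisfies \<open>4x\<^sup>2 F\<^sub>m\<^sub>+\<^sub>2 = (4m + 2) F\<^sub>m\<^sub>+\<^sub>1 - F\<^sub>m\<close> with \<open>F\<^sub>0 = cos x\<close> and
  \<open>2x F\<^sub>1 = sin x\<close>, and it is at most \<open>exp (x\<^sup>2) / m!\<close> in absolute value. For \<open>x = a / b\<close> the
  numbers \<open>(4a\<^sup>2)\<^sup>m F\<^sub>m(x)\<close> obey a recurrence with integer coefficients. If \<open>sin x\<close> and \<open>cos x\<close>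
  were integer multiples of a common real \<open>L \<noteq> 0\<close>, all of these numbers would be integer
  multiples of \<open>L\<close>; as they tend to 0, they would vanish eventually, and by running the
  recurrence backwards \<open>sin x = cos x = 0\<close>.
\<close>

section \<open>The series, its absolute convergence and its decay in \<open>m\<close>\<close>

definition bessel_term :: "nat \<Rightarrow> real \<Rightarrow> nat \<Rightarrow> real" where
  "bessel_term m x k = (-1) ^ k * fact (m + k) / (fact k * fact (2 * m + 2 * k)) * x ^ (2 * k)"

definition bessel_sum :: "nat \<Rightarrow> real \<Rightarrow> real" where
  "bessel_sum m x = (\<Sum>k. bessel_term m x k)"

lemma fact_mult_fact_le: "fact m * fact n \<le> (fact (m + n) :: real)"
proof -
  have "fact m * fact n \<le> (fact (m + n) :: nat)"
    by (rule dvd_imp_le[OF fact_fact_dvd_fact]) simp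
  then have "real (fact m * fact n) \<le> real (fact (m + n))"
    by (simp only: of_nat_le_iff)
  then show ?thesis by simp
qed

text \<open>From \<open>m! (m+k)! \<le> (m+k)!^2 \<le> (2m+2k)!\<close> the factorial quotient is at
  most \<open>1 / m!\<close>. What remains is a term of the exponential series at
  \<open>x^2\<close>, so one bound gives both summability and decay in \<open>m\<close>.\<close>

lemma abs_bessel_term_le: "\<bar>bessel_term m x k\<bar> \<le> (x\<^sup>2) ^ k / fact k / fact m"
proof -
  have "fact m * fact (m + k) \<le> (fact (m + k) * fact (m + k) :: real)"
    by (intro mult_right_mono fact_mono) auto
  also have "\<dots> \<le> fact (2 * m + 2 * k)"
    using fact_mult_fact_le[of "m + k" "m + k"] by (simp add: mult_2 add_ac)
  finally have "fact (m + k) / fact (2 * m + 2 * k) \<le> (1 / fact m :: real)"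
    by (simp add: field_simps)
  then have "(x\<^sup>2) ^ k / fact k * (fact (m + k) / fact (2 * m + 2 * k)) \<le> (x\<^sup>2) ^ k / fact k * (1 / fact m)"
    by (intro mult_left_mono) auto
  moreover have "\<bar>x ^ (2 * k)\<bar> = (x\<^sup>2) ^ k"
    by (simp add: power_mult)
  ultimately show ?thesis
    by (simp add: bessel_term_def abs_mult mult_ac)
qed

lemma exp_bound_sums: "(\<lambda>k. (x\<^sup>2) ^ k / fact k / fact m) sums (exp (x\<^sup>2) / fact m :: real)"
  using exp_converges[of "x\<^sup>2"] by (intro sums_divide) (simp add: divide_inverse mult.commute)

lemma summable_abs_bessel_term: "summable (\<lambda>k. \<bar>bessel_term m x k\<bar>)"
  using sums_summable[OF exp_bound_sums[of x m]]
  by (rule summable_comparison_test'[where N = 0]) (use abs_bessel_term_le in auto)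

lemma summable_bessel_term: "summable (bessel_term m x)"
  using summable_abs_bessel_term by (rule summable_rabs_cancel)

lemma abs_bessel_sum_le: "\<bar>bessel_sum m x\<bar> \<le> exp (x\<^sup>2) / fact m"
proof -
  have "\<bar>bessel_sum m x\<bar> \<le> (\<Sum>k. \<bar>bessel_term m x k\<bar>)"
    unfolding bessel_sum_def by (rule summable_rabs[OF summable_abs_bessel_term])
  also have "\<dots> \<le> exp (x\<^sup>2) / fact m"
    using suminf_le[OF abs_bessel_term_le summable_abs_bessel_term sums_summable[OF exp_bound_sums]]
    by (simp add: sums_unique[OF exp_bound_sums])
  finally show ?thesis .
qed

section \<open>Initial values and the three-term recurrence\<close>

lemma bessel_sum_0: "bessel_sum 0 x = cos x"
proof -
  have "bessel_term 0 x = (\<lambda>k. (-1) ^ k / fact (2 * k) * x ^ (2 * k))"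
    by (simp add: bessel_term_def fun_eq_iff)
  then show ?thesis
    using cos_paired[of x] by (simp add: bessel_sum_def sums_iff)
qed

lemma bessel_sum_1: "2 * x * bessel_sum 1 x = sin x"
proof -
  have "2 * x * bessel_term 1 x k = (-1) ^ k / fact (2 * k + 1) * x ^ (2 * k + 1)" for k
  proof -
    have "2 * fact (Suc k) / (fact k * fact (2 + 2 * k)) = (1 / fact (2 * k + 1) :: real)"
      by (simp add: divide_simps del: of_nat_Suc) (simp add: algebra_simps)
    moreover have "2 * x * bessel_term 1 x k =
        (-1) ^ k * (2 * fact (Suc k) / (fact k * fact (2 + 2 * k))) * x ^ (2 * k + 1)"
      by (simp add: bessel_term_def del: fact_Suc)
    ultimately show ?thesis by simp
  qed
  then have "(\<lambda>k. 2 * x * bessel_term 1 x k) sums sin x"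
    using sin_paired[of x] by simp
  then show ?thesis
    using suminf_mult[OF summable_bessel_term, of "2 * x" 1 x] by (simp add: bessel_sum_def sums_iff)
qed

text \<open>The constant coefficient of the recurrence, where the side with the factor
  \<open>x^2\<close> contributes nothing:
  \<open>(m+1) / ((2m+1)(2m+2)) = 1 / (4m+2)\<close>.\<close>

lemma bessel_term_rec_0: "bessel_term m x 0 = (4 * real m + 2) * bessel_term (Suc m) x 0"
  by (simp add: bessel_term_def divide_simps del: of_nat_Suc) (simp add: algebra_simps)

text \<open>The coefficient of \<open>x^(2k+2)\<close> in the recurrence; the index on the left is
  one lower because of the factor \<open>x^2\<close>. With common factors removed it says
  \<open>4(k+1) = 2(2m+2k+3) - (4m+2)\<close>.\<close>

lemma bessel_term_rec_Suc:
  "4 * x\<^sup>2 * bessel_term (Suc (Suc m)) x k =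
     (4 * real m + 2) * bessel_term (Suc m) x (Suc k) - bessel_term m x (Suc k)"
proof -
  define Q :: real where "Q = fact (Suc m + k) / fact (2 * m + 2 * k + 2)"
  define C :: real where "C = fact k"
  define u where "u = real m"
  define v where "v = real k"
  have pos: "C > 0" "u \<ge> 0" "v \<ge> 0"
    by (simp_all add: C_def u_def v_def)
  have fact_k: "fact (Suc k) = (v + 1) * C"
    by (simp add: C_def v_def algebra_simps)
  \<comment> \<open>Passing from \<open>Q\<close> to the next quotient multiplies by
    \<open>(m+k+2) / ((2m+2k+4)(2m+2k+3))\<close>, in which \<open>m+k+2\<close> cancels.\<close>
  have ratio: "fact (Suc (Suc m + k)) / fact (2 * m + 2 * k + 4) = Q / (2 * (2 * u + 2 * v + 3))"
  proof -
    have num: "fact (Suc (Suc m + k)) = (u + v + 2) * (fact (Suc m + k) :: real)"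
      unfolding fact_Suc[of "Suc m + k"] by (simp add: u_def v_def del: fact_Suc)
    have "2 * m + 2 * k + 4 = Suc (Suc (2 * m + 2 * k + 2))" by simp
    then have den: "fact (2 * m + 2 * k + 4) =
        (u + v + 2) * (2 * (2 * u + 2 * v + 3) * (fact (2 * m + 2 * k + 2) :: real))"
      by (simp only: fact_Suc) (simp add: u_def v_def algebra_simps del: fact_Suc)
    have nz: "u + v + 2 \<noteq> 0" using pos by linarith
    show ?thesis
      unfolding num den Q_def mult_divide_mult_cancel_left[OF nz]
      by (simp only: divide_divide_eq_left mult_ac)
  qed
  have idx: "2 * Suc (Suc m) + 2 * k = 2 * m + 2 * k + 4" "2 * Suc m + 2 * Suc k = 2 * m + 2 * k + 4"
    "2 * m + 2 * Suc k = 2 * m + 2 * k + 2" "Suc (Suc m) + k = Suc (Suc m + k)"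
    "Suc m + Suc k = Suc (Suc m + k)" "m + Suc k = Suc m + k"
    by simp_all
  have pow: "x ^ (2 * Suc k) = x ^ (2 * k) * x\<^sup>2" "(-1) ^ Suc k = - ((-1) ^ k :: real)"
    by (simp_all add: power2_eq_square)
  have t1: "bessel_term (Suc (Suc m)) x k = (-1) ^ k * x ^ (2 * k) *
      (fact (Suc (Suc m + k)) / fact (2 * m + 2 * k + 4) / C)"
    unfolding bessel_term_def idx pow Q_def C_def by (simp add: mult_ac del: fact_Suc)
  have t2: "bessel_term (Suc m) x (Suc k) = - ((-1) ^ k * x ^ (2 * k)) * x\<^sup>2 *
      (fact (Suc (Suc m + k)) / fact (2 * m + 2 * k + 4) / fact (Suc k))"
    unfolding bessel_term_def idx pow Q_def C_def by (simp add: mult_ac del: fact_Suc)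
  have t3: "bessel_term m x (Suc k) = - ((-1) ^ k * x ^ (2 * k)) * x\<^sup>2 *
      (Q / fact (Suc k))"
    unfolding bessel_term_def idx pow Q_def C_def by (simp add: mult_ac del: fact_Suc)
  have key: "4 * (fact (Suc (Suc m + k)) / fact (2 * m + 2 * k + 4) / C) =
      Q / fact (Suc k) - (4 * u + 2) * (fact (Suc (Suc m + k)) / fact (2 * m + 2 * k + 4) / fact (Suc k))"
  proof -
    define s where "s = 2 * u + 2 * v + 3"
    have nz: "v + 1 \<noteq> 0" "s \<noteq> 0" "C \<noteq> 0"
      using pos by (auto simp: s_def)
    have "Q / fact (Suc k) = (2 * s) * Q / (2 * s * (v + 1) * C)"
      unfolding fact_k using nz by simp
    moreover have "(4 * u + 2) * (Q / (2 * s) / fact (Suc k)) = (4 * u + 2) * Q / (2 * s * (v + 1) * C)"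
      unfolding fact_k by simp
    moreover have "4 * (Q / (2 * s) / C) = (4 * (v + 1)) * Q / (2 * s * (v + 1) * C)"
    proof -
      have "(4 * (v + 1)) * Q / (2 * s * (v + 1) * C) = ((v + 1) * (4 * Q)) / ((v + 1) * (2 * s * C))"
        by (simp only: mult_ac)
      then show ?thesis
        unfolding mult_divide_mult_cancel_left[OF nz(1)] by (simp only: divide_divide_eq_left times_divide_eq_right)
    qed
    \<comment> \<open>The comparison of numerators over the common denominator
      \<open>2s(v+1)C\<close>.\<close>
    moreover have "4 * (v + 1) * Q = 2 * s * Q - (4 * u + 2) * Q"
      by (simp add: s_def algebra_simps)
    ultimately show ?thesis
      unfolding ratio s_def[symmetric] by (simp only: diff_divide_distrib)
  qed
  have "4 * x\<^sup>2 * bessel_term (Suc (Suc m)) x k = (-1) ^ k * x ^ (2 * k) * x\<^sup>2 *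
      (4 * (fact (Suc (Suc m + k)) / fact (2 * m + 2 * k + 4) / C))"
    unfolding t1 by (simp only: mult_ac)
  also have "\<dots> = (4 * real m + 2) * bessel_term (Suc m) x (Suc k) - bessel_term m x (Suc k)"
    unfolding key t2 t3 u_def[symmetric] by algebra
  finally show ?thesis .
qed

lemma sums_bessel_sum: "bessel_term m x sums bessel_sum m x"
  unfolding bessel_sum_def by (rule summable_sums[OF summable_bessel_term])

lemma bessel_sum_rec:
  "4 * x\<^sup>2 * bessel_sum (Suc (Suc m)) x = (4 * real m + 2) * bessel_sum (Suc m) x - bessel_sum m x"
proof -
  let ?f = "\<lambda>k. (4 * real m + 2) * bessel_term (Suc m) x k - bessel_term m x k"
  let ?s = "(4 * real m + 2) * bessel_sum (Suc m) x - bessel_sum m x"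
  have "?f sums ?s"
    by (rule sums_diff[OF sums_mult[OF sums_bessel_sum] sums_bessel_sum])
  \<comment> \<open>The vanishing first term allows the index shift without changing the
    sum.\<close>
  moreover have "?f 0 = 0"
    unfolding bessel_term_rec_0[of m] by (rule diff_self)
  ultimately have "(\<lambda>k. ?f (Suc k)) sums ?s"
    using sums_Suc_iff[of ?f ?s] by (simp only: add_0_right)
  moreover have "(\<lambda>k. ?f (Suc k)) sums (4 * x\<^sup>2 * bessel_sum (Suc (Suc m)) x)"
    using sums_mult[OF sums_bessel_sum, of "4 * x\<^sup>2" "Suc (Suc m)" x]
    by (simp only: bessel_term_rec_Suc)
  ultimately show ?thesis
    by (rule sums_unique2[symmetric])
qed

section \<open>Integrality, smallness and the contradiction\<close>

lemma integer_recurrence_tendsto_0: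
  fixes W :: "nat \<Rightarrow> real" and c :: "nat \<Rightarrow> int" and d :: int
  assumes rec: "\<And>m. W (Suc (Suc m)) = c m * W (Suc m) - d * W m"
    and "d \<noteq> 0" "L \<noteq> 0"
    and init: "W 0 = L * of_int i" "W 1 = L * of_int j"
    and lim: "W \<longlonglongrightarrow> 0"
  shows "W m = 0"
proof -
  \<comment> \<open>The recurrence has order two, so the induction carries two consecutive
    values.\<close>
  have mult: "(\<exists>k::int. W m = L * k) \<and> (\<exists>k::int. W (Suc m) = L * k)" for m
  proof (induction m)
    case 0
    then show ?case using init by auto
  next
    case (Suc m)
    then obtain k l :: int where kl: "W m = L * k" "W (Suc m) = L * l" by blast
    then have "W (Suc (Suc m)) = L * of_int (c m * l - d * k)"
      by (simp add: rec algebra_simps)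
    with kl show ?case by blast
  qed
  have "eventually (\<lambda>m. \<bar>W m\<bar> < \<bar>L\<bar>) sequentially"
    using order_tendstoD(2)[OF tendsto_rabs[OF lim], of "\<bar>L\<bar>"] \<open>L \<noteq> 0\<close> by simp
  then obtain N where N: "\<And>m. m \<ge> N \<Longrightarrow> \<bar>W m\<bar> < \<bar>L\<bar>"
    by (auto simp: eventually_sequentially)
  have zero: "W m = 0" if m: "m \<ge> N" for m
  proof -
    obtain k :: int where k: "W m = L * k" using mult by blast
    with N[OF m] have "\<bar>L\<bar> * \<bar>real_of_int k\<bar> < \<bar>L\<bar> * 1" by (simp add: abs_mult)
    then have "\<bar>real_of_int k\<bar> < 1" by (rule mult_left_less_imp_less) simp
    then have "k = 0" by linarith
    with k show ?thesis by simp
  qed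
  \<comment> \<open>Downward induction from \<open>N\<close>: two consecutive zeros force the
    preceding value to be zero, since \<open>d\<close> can be cancelled.\<close>
  have "W m = 0 \<and> W (Suc m) = 0" if "m \<le> N" for m
    using that
  proof (induction m rule: inc_induct)
    case base
    then show ?case by (simp add: zero)
  next
    case (step n)
    have "real_of_int d * W n = c n * W (Suc n) - W (Suc (Suc n))" using rec[of n] by simp
    then show ?case using step.IH \<open>d \<noteq> 0\<close> by simp
  qed
  with zero show ?thesis by (meson nle_le)
qed

text \<open>The common unit \<open>L\<close> need not be rational. This lets one statement cover
  both a rational tangent and a vanishing cosine.\<close>

lemma sin_cos_not_commensurable:
  fixes a b i j :: int and L :: real
  assumes "a \<noteq> 0" "b \<noteq> 0" "L \<noteq> 0"
  shows "\<not> (cos (a / b) = L * i \<and> sin (a / b) = L * j)"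
proof
  define x :: real where "x = a / b"
  assume "cos (a / b) = L * i \<and> sin (a / b) = L * j"
  then have ij: "cos x = L * i" "sin x = L * j" by (simp_all add: x_def)
  define W where "W = (\<lambda>m. (4 * (real_of_int a)\<^sup>2) ^ m * bessel_sum m x)"
  have xb: "x * b = a" using assms by (simp add: x_def)
  have W0: "W 0 = cos x" by (simp add: W_def bessel_sum_0)
  have W1: "W 1 = 2 * a * b * sin x"
  proof -
    have "2 * a * b * sin x = 4 * a * (x * b) * bessel_sum 1 x"
      by (simp add: bessel_sum_1[of x, symmetric])
    then show ?thesis unfolding xb by (simp only: W_def) (simp add: power2_eq_square)
  qed
  have "W m = 0" for m
  \<comment> \<open>Since \<open>a = x b\<close>, we have \<open>4a^2 = b^2 * 4x^2\<close>;
    multiplying the recurrence for \<open>bessel_sum\<close> by \<open>b^2 (4a^2)^(m+1)\<close>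
    gives these integers \<open>c\<close> and \<open>d\<close>. The value of \<open>j\<close> comes
    from \<open>W1\<close>.\<close>
  proof (rule integer_recurrence_tendsto_0[where L = L and i = i and j = "2 * a * b * j"
        and c = "\<lambda>m. b\<^sup>2 * (4 * int m + 2)" and d = "4 * a\<^sup>2 * b\<^sup>2"])
    fix m
    have "real_of_int (4 * a\<^sup>2) * bessel_sum (Suc (Suc m)) x =
        b\<^sup>2 * (4 * x\<^sup>2 * bessel_sum (Suc (Suc m)) x)"
      by (simp add: xb[symmetric] power2_eq_square)
    also have "\<dots> = b\<^sup>2 * ((4 * real m + 2) * bessel_sum (Suc m) x - bessel_sum m x)"
      by (simp only: bessel_sum_rec)
    finally have *: "4 * (real_of_int a)\<^sup>2 * bessel_sum (Suc (Suc m)) x =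
        b\<^sup>2 * ((4 * real m + 2) * bessel_sum (Suc m) x - bessel_sum m x)" by simp
    have "W (Suc (Suc m)) = (4 * (real_of_int a)\<^sup>2) ^ Suc m *
        (4 * (real_of_int a)\<^sup>2 * bessel_sum (Suc (Suc m)) x)"
      by (simp add: W_def)
    then show "W (Suc (Suc m)) =
        of_int (b\<^sup>2 * (4 * int m + 2)) * W (Suc m) - of_int (4 * a\<^sup>2 * b\<^sup>2) * W m"
      unfolding * by (simp add: W_def algebra_simps)
  next
    \<comment> \<open>The factorial beats the geometric scaling: \<open>(4a^2)^m / m!\<close> is the
      general term of a convergent exponential series.\<close>
    have "(\<lambda>m. exp (x\<^sup>2) * (inverse (fact m) * (4 * (real_of_int a)\<^sup>2) ^ m)) \<longlonglongrightarrow> exp (x\<^sup>2) * 0"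
      by (intro tendsto_mult tendsto_const summable_LIMSEQ_zero summable_exp)
    then have lim: "(\<lambda>m. exp (x\<^sup>2) * (inverse (fact m) * (4 * (real_of_int a)\<^sup>2) ^ m)) \<longlonglongrightarrow> 0"
      by simp
    show "W \<longlonglongrightarrow> 0"
    proof (rule tendsto_rabs_zero_cancel, rule tendsto_sandwich[OF _ _ tendsto_const lim])
      have "\<bar>W m\<bar> \<le> exp (x\<^sup>2) * (inverse (fact m) * (4 * (real_of_int a)\<^sup>2) ^ m)" for m
      proof -
        have "\<bar>W m\<bar> = (4 * (real_of_int a)\<^sup>2) ^ m * \<bar>bessel_sum m x\<bar>"
          by (simp add: W_def abs_mult)
        also have "\<dots> \<le> (4 * (real_of_int a)\<^sup>2) ^ m * (exp (x\<^sup>2) / fact m)"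
          by (intro mult_left_mono abs_bessel_sum_le) simp
        finally show ?thesis by (simp only: divide_inverse mult_ac)
      qed
      then show "\<forall>\<^sub>F m in sequentially. \<bar>W m\<bar> \<le> exp (x\<^sup>2) * (inverse (fact m) * (4 * (real_of_int a)\<^sup>2) ^ m)"
        by (rule always_eventually[OF allI])
    qed simp
  qed (use assms W0 W1 ij in auto)
  then have "cos x = 0" "sin x = 0"
    using W0 W1 assms by simp_all
  then show False
    using sin_cos_squared_add[of x] by simp
qed

theorem theorem1:
  fixes r :: rat
  assumes "r \<noteq> 0"
  shows "tan (of_rat r :: real) \<notin> \<rat>"
proof
  assume rational: "tan (of_rat r :: real) \<in> \<rat>"
  obtain a b :: int where ab: "r = of_int a / of_int b" "b \<noteq> 0"
    by (cases r) (auto simp: Fract_of_int_quotient)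
  define x :: real where "x = of_int a / of_int b"
  have r: "of_rat r = x" and "a \<noteq> 0"
    using assms ab by (auto simp: x_def of_rat_divide)
  (* tan x is the junk value 0 if cos x = 0, so that case needs its own contradiction. *)
  obtain L :: real and i j :: int where "L \<noteq> 0" "cos x = L * i" "sin x = L * j"
  proof (cases "cos x = 0")
    case True
    then have "sin x \<noteq> 0" using sin_cos_squared_add[of x] by auto
    then show ?thesis using that[of "sin x" 0 1] True by simp
  next
    case False
    obtain p q :: int where pq: "q \<noteq> 0" "tan x = of_int p / of_int q"
      using rational unfolding r by (elim Rats_cases') (metis less_numeral_extra(3))
    \<comment> \<open>Clearing the denominator of \<open>tan x = p / q\<close> suggests
      \<open>L = cos x / q\<close>, with multiples \<open>q\<close> and \<open>p\<close>.\<close>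
    then have "sin x = cos x / q * p"
      using False by (simp add: tan_def field_simps)
    then show ?thesis using that[of "cos x / q" q p] False pq by simp
  qed
  then show False
    using sin_cos_not_commensurable[OF \<open>a \<noteq> 0\<close> \<open>b \<noteq> 0\<close>] by (auto simp: x_def)
qed

end
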